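(* A ternary groupoid $(A,[\,])$ is a knot-theoretic ternary group if and only if it is semi-commutative, satisfies for all $a,b,c,d,e\in A$ the conditions $$[[abc]cd]=[[ab[bcd]][bcd]d],\qquad [a[bcd]e]=[a[bed]c],$$ and there exists on $A$ an involutive unary operation $x\mapsto\bar x$ such that $[a\bar a x]=x$ for all $a,x\in A$.
   Context: A ternary groupoid $(A,[\,])$ is a non-empty set $A$ with a ternary operation $[\,]\colon A^3\to A$. It is a ternary quasigroup if for all $a,b,c\in A$ each of the equations $[zab]=c$, $[azb]=c$, $[abz]=c$ has a unique solution $z\in A$. A ternary group is a ternary quasigroup that is associative: $[[abc]de]=[a[bcd]e]=[ab[cde]]$ for all $a,b,c,d,e\in A$. A knot-theoretic ternary group is a ternary group such that, for all $a,b,c,d\in A$, $[[abc]cd]=[[ab[bcd]][bcd]d]$ and $[ab[bcd]]=[a[abc][[abc]cd]]$. Semi-commutative means $[abc]=[cba]$ for all $a,b,c\in A$. A unary operation is involutive if $\bar{\bar x}=x$ for all $x\in A$. *)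

theory Defs
  imports Main "HOL-Library.FuncSet"
begin

locale ternary_groupoid =
  fixes A :: "'a set" and f :: "'a \<Rightarrow> 'a \<Rightarrow> 'a \<Rightarrow> 'a"
  assumes nonempty: "A \<noteq> {}"
    and closed: "\<lbrakk>a \<in> A; b \<in> A; c \<in> A\<rbrakk> \<Longrightarrow> f a b c \<in> A"

locale ternary_quasigroup = ternary_groupoid +
  assumes solve_left: "\<lbrakk>a \<in> A; b \<in> A; c \<in> A\<rbrakk> \<Longrightarrow> \<exists>!z. z \<in> A \<and> f z a b = c"
    and solve_middle: "\<lbrakk>a \<in> A; b \<in> A; c \<in> A\<rbrakk> \<Longrightarrow> \<exists>!z. z \<in> A \<and> f a z b = c"
    and solve_right: "\<lbrakk>a \<in> A; b \<in> A; c \<in> A\<rbrakk> \<Longrightarrow> \<exists>!z. z \<in> A \<and> f a b z = c"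

locale ternary_group = ternary_quasigroup +
  assumes assoc_left: "\<lbrakk>a \<in> A; b \<in> A; c \<in> A; d \<in> A; e \<in> A\<rbrakk>
      \<Longrightarrow> f (f a b c) d e = f a (f b c d) e"
    and assoc_right: "\<lbrakk>a \<in> A; b \<in> A; c \<in> A; d \<in> A; e \<in> A\<rbrakk>
      \<Longrightarrow> f a (f b c d) e = f a b (f c d e)"

locale knot_theoretic_ternary_group = ternary_group +
  assumes knot_left: "\<lbrakk>a \<in> A; b \<in> A; c \<in> A; d \<in> A\<rbrakk>
      \<Longrightarrow> f (f a b c) c d = f (f a b (f b c d)) (f b c d) d"
    and knot_right: "\<lbrakk>a \<in> A; b \<in> A; c \<in> A; d \<in> A\<rbrakk>
      \<Longrightarrow> f a b (f b c d) = f a (f a b c) (f (f a b c) c d)"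

definition semi_commutative_on :: "'a set \<Rightarrow> ('a \<Rightarrow> 'a \<Rightarrow> 'a \<Rightarrow> 'a) \<Rightarrow> bool" where
  "semi_commutative_on A f \<longleftrightarrow> (\<forall>a\<in>A. \<forall>b\<in>A. \<forall>c\<in>A. f a b c = f c b a)"

definition involutive_on :: "'a set \<Rightarrow> ('a \<Rightarrow> 'a) \<Rightarrow> bool" where
  "involutive_on A g \<longleftrightarrow> g \<in> A \<rightarrow> A \<and> (\<forall>x\<in>A. g (g x) = x)"

end

(* In the covering group, where the skew element is the inverse, cancelling the first knot identity
   gives (bcd)^2 = c^2. Hence all generators have the same square, this square is central, and
   comparing (bcd)(bcd) with (dcb)(bcd) gives bcd = dcb. Conversely, the exchange identity and
   semi-commutativity let the odd letters of [a[bcd]e] be permuted freely, and inserting cancelling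
   pairs into an argument of a product transports this to the other two bracketings. *)
theory Submission imports Defs begin

context ternary_quasigroup
begin

lemma cancel_left:
  assumes "f x a b = f y a b" "a \<in> A" "b \<in> A" "x \<in> A" "y \<in> A"
  shows "x = y"
  using solve_left[of a b "f y a b"] assms closed by blast

lemma cancel_middle:
  assumes "f a x b = f a y b" "a \<in> A" "b \<in> A" "x \<in> A" "y \<in> A"
  shows "x = y"
  using solve_middle[of a b "f a y b"] assms closed by blast

lemma cancel_right:
  assumes "f a b x = f a b y" "a \<in> A" "b \<in> A" "x \<in> A" "y \<in> A"
  shows "x = y"
  using solve_right[of a b "f a b y"] assms closed by blast

definition skew :: "'a \<Rightarrow> 'a" where
  "skew a = (THE z. z \<in> A \<and> f a z a = a)"

lemma skew_closed [simp]: "a \<in> A \<Longrightarrow> skew a \<in> A"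
  and skew_middle: "a \<in> A \<Longrightarrow> f a (skew a) a = a"
  unfolding skew_def using theI'[OF solve_middle[of a a a]] by auto

end

context ternary_group
begin

lemma assoc_outer:
  assumes "a \<in> A" "b \<in> A" "c \<in> A" "d \<in> A" "e \<in> A"
  shows "f (f a b c) d e = f a b (f c d e)"
  using assms assoc_left assoc_right by simp

text \<open>Every \<open>x\<close> can be written as \<open>f a a w\<close>; regrouping then brings
  the defining equation \<open>f a (skew a) a = a\<close> into play.\<close>

lemma skew_neutral_left:
  assumes "a \<in> A" "x \<in> A"
  shows "f a (skew a) x = x"
proof -
  obtain w where w: "w \<in> A" "f a a w = x"
    using solve_right[of a a x] assms by blast
  have "f a (skew a) (f a a w) = f (f a (skew a) a) a w"
    using assms w by (simp add: assoc_outer)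
  then show ?thesis
    using assms w by (simp add: skew_middle)
qed

text \<open>Flanked by two copies of \<open>a\<close>, the product regroups so that
  \<open>f a (skew a) a\<close> collapses to \<open>a\<close>; the flanks are then
  cancelled.\<close>

lemma skew_neutral_left':
  assumes "a \<in> A" "x \<in> A"
  shows "f (skew a) a x = x"
proof (rule cancel_middle)
  show "f a (f (skew a) a x) a = f a x a"
    using assms assoc_left[of a "skew a" a x a] by (simp add: skew_middle)
qed (use assms closed in auto)

lemma skew_skew:
  assumes "a \<in> A"
  shows "skew (skew a) = a"
proof (rule cancel_middle)
  \<comment> \<open>Both \<open>skew (skew a)\<close> and \<open>a\<close> solve the equation that
    defines the skew element of \<open>skew a\<close>.\<close>
  show "f (skew a) (skew (skew a)) (skew a) = f (skew a) a (skew a)"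
    using assms by (simp add: skew_middle skew_neutral_left')
qed (use assms in auto)

lemma skew_neutral_right:
  assumes "a \<in> A" "x \<in> A"
  shows "f x (skew a) a = x"
proof (rule cancel_left)
  show "f (f x (skew a) a) a a = f x a a"
    using assms by (simp add: assoc_left skew_neutral_left')
qed (use assms closed in auto)

lemma skew_neutral_right':
  assumes "a \<in> A" "x \<in> A"
  shows "f x a (skew a) = x"
  using skew_neutral_right[of "skew a" x] assms by (simp add: skew_skew)

end

context knot_theoretic_ternary_group
begin

lemma square_eq:
  assumes "b \<in> A" "c \<in> A" "d \<in> A"
  shows "f c c d = f (f b c d) (f b c d) d"
proof (rule cancel_right)
  \<comment> \<open>The first knot identity with both leading letters equal to \<open>b\<close>,
    regrouped so that the prefix \<open>b b\<close> stands apart.\<close>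
  show "f b b (f c c d) = f b b (f (f b c d) (f b c d) d)"
    using knot_left[of b b c d] assms by (simp add: assoc_outer closed)
qed (use assms closed in auto)

text \<open>Taking \<open>c = skew x\<close> and \<open>d = x\<close> in \<open>square_eq\<close>
  collapses the product \<open>f b c d\<close> to \<open>b\<close>. In the covering group this reads
  b^2 = x^(-2), so all squares of generators agree and are their own inverses.\<close>

lemma square_left:
  assumes "b \<in> A" "x \<in> A"
  shows "f b b x = skew x"
  using square_eq[of b "skew x" x] assms
  by (simp add: skew_neutral_left skew_neutral_right skew_middle)

lemma semi_commutative:
  assumes A: "b \<in> A" "c \<in> A" "d \<in> A"
  shows "f b c d = f d c b"
proof -
  have sq: "f (f b c d) (f b c d) b = skew b"
    using A by (simp add: square_left closed)
  \<comment> \<open>Skewing is prefixing by \<open>c c\<close>, and associativity lets this prefix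
    be absorbed by the first letter alone.\<close>
  have skew_prod: "skew (f c d b) = f (skew c) d b"
    using A square_left[of c "f c d b"] square_left[of c c] assoc_outer[of c c c d b]
    by (simp add: closed)
  \<comment> \<open>The adjacent \<open>b b\<close> skews the block \<open>c d b\<close>; then
    \<open>c\<close> meets \<open>skew c\<close>, and the remaining \<open>d d\<close> skews
    \<open>b\<close>.\<close>
  have "f (f d c b) (f b c d) b = f d c (f b b (f c d b))"
    using A by (simp add: assoc_outer assoc_right closed)
  also have "\<dots> = f d c (f (skew c) d b)"
    using A by (simp add: square_left skew_prod closed)
  also have "\<dots> = f (f d c (skew c)) d b"
    using A by (simp add: assoc_outer)
  also have "\<dots> = skew b"
    using A by (simp add: skew_neutral_right' square_left)
  finally show ?thesis
    using sq A closed cancel_left[of "f b c d" "f b c d" b "f d c b"] by simp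
qed

text \<open>Regrouping makes the last three letters \<open>c d e\<close> a block, which
  semi-commutativity reverses.\<close>

lemma exchange:
  assumes "a \<in> A" "b \<in> A" "c \<in> A" "d \<in> A" "e \<in> A"
  shows "f a (f b c d) e = f a (f b e d) c"
  using assms semi_commutative[of c d e] by (simp add: assoc_right)

end

text \<open>Collects the conditions from which associativity and unique solvability are derived; the
  first knot identity is brought in afterwards.\<close>

locale semi_commutative_exchange_groupoid = ternary_groupoid +
  fixes bar :: "'a \<Rightarrow> 'a"
  assumes semi_commutative: "\<lbrakk>a \<in> A; b \<in> A; c \<in> A\<rbrakk> \<Longrightarrow> f a b c = f c b a"
    and exchange: "\<lbrakk>a \<in> A; b \<in> A; c \<in> A; d \<in> A; e \<in> A\<rbrakk>
      \<Longrightarrow> f a (f b c d) e = f a (f b e d) c"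
    and bar_closed [simp]: "a \<in> A \<Longrightarrow> bar a \<in> A"
    and bar_bar [simp]: "a \<in> A \<Longrightarrow> bar (bar a) = a"
    and bar_neutral_left [simp]: "\<lbrakk>a \<in> A; x \<in> A\<rbrakk> \<Longrightarrow> f a (bar a) x = x"
begin

lemma bar_neutral [simp]:
  assumes "a \<in> A" "x \<in> A"
  shows "f (bar a) a x = x" "f x (bar a) a = x" "f x a (bar a) = x"
  using assms bar_neutral_left[of "bar a" x] bar_neutral_left[of a x]
    semi_commutative[of x "bar a" a] semi_commutative[of x a "bar a"] by simp_all

text \<open>The mirror image of \<open>exchange\<close>. The two swap positions 1, 3 and 3, 5 of the
  five letters, which generates all permutations of the odd positions;
  \<open>exchange_middle\<close> swaps the even ones.\<close>

lemma exchange_left: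
  assumes "a \<in> A" "b \<in> A" "c \<in> A" "d \<in> A" "e \<in> A"
  shows "f a (f b c d) e = f c (f b a d) e"
proof -
  have "f a (f b c d) e = f e (f b c d) a"
    using assms by (simp add: semi_commutative[of a] closed)
  also have "\<dots> = f e (f b a d) c"
    using assms by (simp add: exchange)
  also have "\<dots> = f c (f b a d) e"
    using assms by (simp add: semi_commutative[of e] closed)
  finally show ?thesis .
qed

lemma exchange_middle:
  assumes "a \<in> A" "b \<in> A" "c \<in> A" "d \<in> A" "e \<in> A"
  shows "f a (f b c d) e = f a (f d c b) e"
  using assms by (simp add: semi_commutative[of b])

lemma cancel_bar:
  assumes "a \<in> A" "b \<in> A" "c \<in> A" "p \<in> A"
  shows "f p (f a b c) (bar c) = f p a b"
  \<comment> \<open>The exchange moves \<open>bar c\<close> next to \<open>c\<close> inside the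
    inner product, where the pair vanishes.\<close>
  using assms by (subst exchange) simp_all

lemma assoc_left:
  assumes A: "a \<in> A" "b \<in> A" "c \<in> A" "d \<in> A" "e \<in> A"
  shows "f (f a b c) d e = f a (f b c d) e"
proof -
  \<comment> \<open>Expanding \<open>d\<close> to \<open>f d c (bar c)\<close> creates a nested
    middle argument, so \<open>f a b c\<close> can be exchanged into it and lose its last letter
    against \<open>bar c\<close>.\<close>
  have "f (f a b c) d e = f (f a b c) (f d c (bar c)) e"
    using A by simp
  also have "\<dots> = f c (f d (f a b c) (bar c)) e"
    using A by (subst exchange_left) (simp_all add: closed)
  also have "\<dots> = f c (f d a b) e"
    using A by (simp add: cancel_bar)
  also have "\<dots> = f a (f d c b) e"
    using A by (simp add: exchange_left)
  also have "\<dots> = f a (f b c d) e"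
    using A by (simp add: exchange_middle)
  finally show ?thesis .
qed

text \<open>This is \<open>assoc_left\<close> with all five letters read in reverse order.\<close>

lemma assoc_right:
  assumes A: "a \<in> A" "b \<in> A" "c \<in> A" "d \<in> A" "e \<in> A"
  shows "f a (f b c d) e = f a b (f c d e)"
proof -
  have "f a b (f c d e) = f (f e d c) b a"
    using A semi_commutative[of a b "f c d e"] semi_commutative[of c d e] by (simp add: closed)
  also have "\<dots> = f e (f d c b) a"
    using A by (simp add: assoc_left)
  also have "\<dots> = f a (f b c d) e"
    using A semi_commutative[of e "f d c b" a] semi_commutative[of d c b] by (simp add: closed)
  finally show ?thesis by simp
qed

lemma ternary_group: "ternary_group A f"
proof
  fix a b c assume A: "a \<in> A" "b \<in> A" "c \<in> A"
  \<comment> \<open>With \<open>bar\<close> as inversion, the solution is the group element c b^(-1)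
    a^(-1).\<close>
  have sol: "f (f c (bar b) (bar a)) a b = c"
    using A by (simp add: assoc_left assoc_right)
  have uni: "z = f c (bar b) (bar a)" if "z \<in> A" "f z a b = c" for z
    using that A by (auto simp: assoc_left assoc_right closed)
  show left: "\<exists>!z. z \<in> A \<and> f z a b = c"
    using sol uni A closed by (intro ex1I[of _ "f c (bar b) (bar a)"]) auto
  \<comment> \<open>The order \<open>b a\<close> makes this equation the exact reversal of the one
    just solved.\<close>
  show "\<exists>!z. z \<in> A \<and> f b a z = c"
    using left A semi_commutative by metis
  \<comment> \<open>Here the solution is a^(-1) c b^(-1).\<close>
  have sol: "f a (f (bar a) c (bar b)) b = c"
    using A by (simp add: assoc_right)
  have uni: "z = f (bar a) c (bar b)" if "z \<in> A" "f a z b = c" for z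
  proof -
    have "f (bar a) (f a z b) (bar b) = z"
      using that(1) A by (simp add: assoc_right)
    then show ?thesis using that(2) by metis
  qed
  show "\<exists>!z. z \<in> A \<and> f a z b = c"
    using sol uni A closed by (intro ex1I[of _ "f (bar a) c (bar b)"]) auto
qed (simp_all add: assoc_left assoc_right)

lemma knot_theoretic_ternary_group:
  assumes knot: "\<And>a b c d. \<lbrakk>a \<in> A; b \<in> A; c \<in> A; d \<in> A\<rbrakk>
      \<Longrightarrow> f (f a b c) c d = f (f a b (f b c d)) (f b c d) d"
  shows "knot_theoretic_ternary_group A f"
proof -
  interpret ternary_group A f by (rule ternary_group)
  show ?thesis
  proof
    fix a b c d assume A: "a \<in> A" "b \<in> A" "c \<in> A" "d \<in> A"
    show "f (f a b c) c d = f (f a b (f b c d)) (f b c d) d"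
      using A by (rule knot)
    have "f a b (f b c d) = f (f d c b) b a"
      using A semi_commutative[of a b "f b c d"] semi_commutative[of b c d] by (simp add: closed)
    \<comment> \<open>The second knot identity is the first one for \<open>d, c, b, a\<close>, with
      every product reversed before and after.\<close>
    also have "\<dots> = f (f d c (f c b a)) (f c b a) a"
      using A by (simp add: knot)
    also have "\<dots> = f a (f a b c) (f (f a b c) c d)"
      using A semi_commutative[of "f d c (f a b c)" "f a b c" a]
        semi_commutative[of c b a] semi_commutative[of d c "f a b c"]
      by (simp add: closed)
    finally show "f a b (f b c d) = f a (f a b c) (f (f a b c) c d)" .
  qed
qed

end

theorem theorem5p6:
  fixes A :: "'a set" and f :: "'a \<Rightarrow> 'a \<Rightarrow> 'a \<Rightarrow> 'a"
  assumes "ternary_groupoid A f"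
  shows "knot_theoretic_ternary_group A f \<longleftrightarrow>
    semi_commutative_on A f \<and>
    (\<forall>a\<in>A. \<forall>b\<in>A. \<forall>c\<in>A. \<forall>d\<in>A.
      f (f a b c) c d = f (f a b (f b c d)) (f b c d) d) \<and>
    (\<forall>a\<in>A. \<forall>b\<in>A. \<forall>c\<in>A. \<forall>d\<in>A. \<forall>e\<in>A.
      f a (f b c d) e = f a (f b e d) c) \<and>
    (\<exists>bar. involutive_on A bar \<and> (\<forall>a\<in>A. \<forall>x\<in>A. f a (bar a) x = x))"
    (is "?knot \<longleftrightarrow> ?semi \<and> ?left \<and> ?exchange \<and> ?bar")
proof
  assume ?knot
  then interpret knot_theoretic_ternary_group A f .
  have "?semi"
    using semi_commutative by (simp add: semi_commutative_on_def)
  moreover have "?left"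
    using knot_left by blast
  moreover have "?exchange"
    using exchange by blast
  moreover have "?bar"
    by (rule exI[of _ skew]) (simp add: involutive_on_def skew_skew skew_neutral_left)
  ultimately show "?semi \<and> ?left \<and> ?exchange \<and> ?bar" by blast
next
  assume R: "?semi \<and> ?left \<and> ?exchange \<and> ?bar"
  then obtain bar where bar: "involutive_on A bar" "\<forall>a\<in>A. \<forall>x\<in>A. f a (bar a) x = x"
    by blast
  interpret ternary_groupoid A f by (rule assms)
  interpret semi_commutative_exchange_groupoid A f bar
  proof
    show "f a b c = f c b a" if "a \<in> A" "b \<in> A" "c \<in> A" for a b c
      using R that unfolding semi_commutative_on_def by blast
    show "f a (f b c d) e = f a (f b e d) c"
      if "a \<in> A" "b \<in> A" "c \<in> A" "d \<in> A" "e \<in> A" for a b c d e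
      using R that by blast
  qed (use bar in \<open>auto simp: involutive_on_def\<close>)
  show ?knot
    by (rule knot_theoretic_ternary_group) (use R in blast)
qed

end
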